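(* Let $\alpha\in(0,1)$ and let $X$ and $Y$ be real random variables with $\mathbb{E}|X|<\infty$ and $\mathbb{E}|Y|<\infty$, with cumulative distribution functions $F_X$ and $F_Y$. Let $g:\mathbb{R}\to[0,\infty)$ be right-continuous and monotonically increasing (in the non-strict sense), with $\lim_{x\to-\infty}g(x)=0$. Define $F_{Y^L}(y)=\min(1,F_Y(y)+g(y))$ for $y\in\mathbb{R}$. If $F_X(x)\le F_Y(x)+g(x)$ for all $x\in\mathbb{R}$, then $F_{Y^L}$ is a cumulative distribution function and, for a random variable $Y^L$ with CDF $F_{Y^L}$, $$\mathrm{CVaR}_\alpha(Y^L)\le\mathrm{CVaR}_\alpha(X).$$
   Context: For a random variable $Z$ and a level $\alpha\in(0,1)$, $\mathrm{CVaR}_\alpha(Z)=\inf_{w\in\mathbb{R}}\{w+\frac{1}{\alpha}\mathbb{E}[(Z-w)^+]\}$, where $(x)^+=\max(x,0)$. It depends only on the distribution of $Z$. $F_Z(z)=P(Z\le z)$ denotes the CDF. A function is a CDF if it is non-decreasing, right-continuous, takes values in $[0,1]$, and has limits $0$ at $-\infty$ and $1$ at $+\infty$. *)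

theory Defs
  imports "HOL-Probability.Probability"
begin

definition is_cdf :: "(real \<Rightarrow> real) \<Rightarrow> bool" where
  "is_cdf F \<longleftrightarrow>
     mono F \<and> (\<forall>x. continuous (at_right x) F) \<and> (\<forall>x. 0 \<le> F x \<and> F x \<le> 1) \<and>
     (F \<longlongrightarrow> 0) at_bot \<and> (F \<longlongrightarrow> 1) at_top"

text \<open>The expectation of the nonnegative variable \<open>(Z - w)\<^sup>+\<close> is taken in
  \<open>[0, \<infinity>]\<close> and the infimum in the extended reals, so that no convention for
  non-integrable variables or unbounded infima enters; only measurability of \<open>Z\<close>
  is needed. For integrable \<open>Z\<close> and \<open>\<alpha> \<in> (0, 1)\<close> the value is real, see
  \<open>CVaR_integrable\<close> below.\<close>

definition CVaR :: "'a measure \<Rightarrow> real \<Rightarrow> ('a \<Rightarrow> real) \<Rightarrow> ereal" where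
  "CVaR M \<alpha> Z =
     (INF w::real. ereal w +
        ereal (1 / \<alpha>) * enn2ereal (\<integral>\<^sup>+ \<omega>. ennreal (max (Z \<omega> - w) 0) \<partial>M))"

lemma CVaR_integrable:
  assumes "prob_space M" and Z: "integrable M Z" and a: "0 < \<alpha>" "\<alpha> < 1"
  shows "CVaR M \<alpha> Z =
     ereal (INF w::real. w + 1 / \<alpha> * (\<integral>\<omega>. max (Z \<omega> - w) 0 \<partial>M))"
proof -
  interpret prob_space M by fact
  define f where "f w = w + 1 / \<alpha> * (\<integral>\<omega>. max (Z \<omega> - w) 0 \<partial>M)" for w :: real
  have int: "integrable M (\<lambda>\<omega>. max (Z \<omega> - w) 0)" for w
    using Z by (intro integrable_max) auto
  have pos: "0 \<le> (\<integral>\<omega>. max (Z \<omega> - w) 0 \<partial>M)" for w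
    by (rule integral_nonneg_AE) auto
  have nn: "(\<integral>\<^sup>+ \<omega>. ennreal (max (Z \<omega> - w) 0) \<partial>M) = ennreal (\<integral>\<omega>. max (Z \<omega> - w) 0 \<partial>M)" for w
    by (rule nn_integral_eq_integral[OF int]) auto
  have f: "ereal w + ereal (1 / \<alpha>) * enn2ereal (\<integral>\<^sup>+ \<omega>. ennreal (max (Z \<omega> - w) 0) \<partial>M) = ereal (f w)" for w
    unfolding nn f_def using pos[of w] by (simp add: enn2ereal_ennreal)
  have low: "(\<integral>\<omega>. Z \<omega> \<partial>M) \<le> f w" for w
  proof -
    have "(\<integral>\<omega>. Z \<omega> \<partial>M) - w = (\<integral>\<omega>. Z \<omega> - w \<partial>M)"
      using Z by (simp add: prob_space)
    also have "\<dots> \<le> (\<integral>\<omega>. max (Z \<omega> - w) 0 \<partial>M)"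
      using Z int by (intro integral_mono) auto
    also have "\<dots> \<le> 1 / \<alpha> * (\<integral>\<omega>. max (Z \<omega> - w) 0 \<partial>M)"
      using mult_right_mono[OF _ pos[of w], of 1 "1 / \<alpha>"] a by simp
    finally show ?thesis by (simp add: f_def)
  qed
  have "bdd_below (range f)" using low by (auto intro!: bdd_belowI)
  then have "ereal (Inf (range f)) = (INF x\<in>range f. ereal x)"
    by (intro ereal_Inf') auto
  then show ?thesis
    unfolding CVaR_def f by (simp add: f_def image_image)
qed

end

theory Submission
  imports Defs
begin

text \<open>By Tonelli, \<open>E[(Z - w)\<^sup>+]\<close> is the integral of the tail \<open>1 - F\<^sub>Z\<close> over
  \<open>[w, \<infinity>)\<close>. Hence a pointwise larger CDF gives a smaller objective for every \<open>w\<close>,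
  and so a smaller \<open>CVaR\<close>; the hypothesis says exactly that \<open>F\<^sub>X \<le> F\<^sub>L\<close>.\<close>

lemma (in prob_space) nn_integral_excess_eq_tail:
  fixes Z :: "'a \<Rightarrow> real" and w :: real
  assumes Z[measurable]: "Z \<in> borel_measurable M"
  shows "(\<integral>\<^sup>+ \<omega>. ennreal (max (Z \<omega> - w) 0) \<partial>M) =
    (\<integral>\<^sup>+ t. ennreal (1 - cdf (distr M borel Z) t) * indicator {w..} t \<partial>lborel)"
proof -
  interpret lb: pair_sigma_finite M lborel
    by (intro pair_sigma_finite.intro sigma_finite_measure_axioms sigma_finite_lborel)
  interpret D: prob_space "distr M borel Z"
    by (rule prob_space_distr) simp
  \<comment> \<open>\<open>cdf\<close> measures the closed ray \<open>{..t}\<close>, so its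
    complement is the strict event \<open>t < Z \<omega>\<close>; this is exact even where the law
    of \<open>Z\<close> has an atom.\<close>
  have tail: "emeasure M {\<omega> \<in> space M. t < Z \<omega>} = ennreal (1 - cdf (distr M borel Z) t)" for t
  proof -
    have "emeasure M {\<omega> \<in> space M. t < Z \<omega>} = emeasure (distr M borel Z) {t<..}"
      by (subst emeasure_distr) (auto intro!: arg_cong[where f = "emeasure M"])
    also have "\<dots> = ennreal (measure (distr M borel Z) (space (distr M borel Z) - {..t}))"
      by (simp add: D.emeasure_eq_measure Compl_atMost flip: Compl_eq_Diff_UNIV)
    also have "\<dots> = ennreal (1 - cdf (distr M borel Z) t)"
      by (subst D.prob_compl) (auto simp: cdf_def)
    finally show ?thesis .
  qed
  \<comment> \<open>Layer cake: the excess is the length of \<open>{w..<Z \<omega>}\<close>, an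
    interval that is empty when \<open>Z \<omega>\<close> \<le> \<open>w\<close>. It is open on the
    right so that fixing \<open>t\<close> leaves the strict event of \<open>tail\<close>.\<close>
  have "(\<integral>\<^sup>+ \<omega>. ennreal (max (Z \<omega> - w) 0) \<partial>M) =
      (\<integral>\<^sup>+ \<omega>. (\<integral>\<^sup>+ t. indicator {w..<Z \<omega>} t \<partial>lborel) \<partial>M)"
    by (intro nn_integral_cong) (auto simp: max_def ennreal_neg)
  \<comment> \<open>The integrand is recast as the indicator of one set of pairs, jointly measurable
    as Tonelli requires.\<close>
  also have "\<dots> = (\<integral>\<^sup>+ \<omega>. (\<integral>\<^sup>+ t. indicator {p. w \<le> snd p \<and> snd p < Z (fst p)} (\<omega>, t) \<partial>lborel) \<partial>M)"
    by (intro nn_integral_cong) (auto simp: indicator_def)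
  also have "\<dots> = (\<integral>\<^sup>+ t. (\<integral>\<^sup>+ \<omega>. indicator {p. w \<le> snd p \<and> snd p < Z (fst p)} (\<omega>, t) \<partial>M) \<partial>lborel)"
    by (rule lb.Fubini'[symmetric]) measurable
  \<comment> \<open>The condition \<open>w\<close> \<le> \<open>t\<close> does not involve
    \<open>\<omega>\<close>, so it leaves the inner integral as a constant factor.\<close>
  also have "\<dots> = (\<integral>\<^sup>+ t. (\<integral>\<^sup>+ \<omega>. indicator {w..} t * indicator {\<omega> \<in> space M. t < Z \<omega>} \<omega> \<partial>M) \<partial>lborel)"
    by (intro nn_integral_cong) (auto simp: indicator_def)
  also have "\<dots> = (\<integral>\<^sup>+ t. indicator {w..} t * emeasure M {\<omega> \<in> space M. t < Z \<omega>} \<partial>lborel)"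
    by (intro nn_integral_cong) (simp add: nn_integral_cmult)
  finally show ?thesis by (simp add: tail mult.commute)
qed

text \<open>The tail formula moves both expectations to \<open>lborel\<close>, so variables on
  unrelated spaces are compared without a coupling.\<close>

lemma CVaR_antimono_cdf:
  fixes Z :: "'a \<Rightarrow> real" and X :: "'b \<Rightarrow> real"
  assumes "prob_space P" "prob_space M" "Z \<in> borel_measurable P" "X \<in> borel_measurable M"
    and "0 \<le> \<alpha>"
    and le: "\<And>t. cdf (distr M borel X) t \<le> cdf (distr P borel Z) t"
  shows "CVaR P \<alpha> Z \<le> CVaR M \<alpha> X"
proof -
  have "(\<integral>\<^sup>+ \<omega>. ennreal (max (Z \<omega> - w) 0) \<partial>P) \<le> (\<integral>\<^sup>+ \<omega>. ennreal (max (X \<omega> - w) 0) \<partial>M)" for w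
    unfolding prob_space.nn_integral_excess_eq_tail[OF assms(1,3)]
      prob_space.nn_integral_excess_eq_tail[OF assms(2,4)]
    using le by (intro nn_integral_mono mult_right_mono ennreal_leI) auto
  then show ?thesis
    \<comment> \<open>The objectives are compared at the same \<open>w\<close>. The factor
      \<open>1 / \<alpha>\<close> is nonnegative also at \<open>\<alpha> = 0\<close>, where division
      yields 0.\<close>
    unfolding CVaR_def using \<open>0 \<le> \<alpha>\<close>
    by (intro INF_mono') (auto intro!: add_left_mono ereal_mult_left_mono simp: less_eq_ennreal.rep_eq)
qed

lemma is_cdf_min_one_add:
  fixes F g :: "real \<Rightarrow> real"
  assumes F: "is_cdf F" and g: "\<And>x. 0 \<le> g x" "\<And>x. continuous (at_right x) g" "mono g"
    "(g \<longlongrightarrow> 0) at_bot"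
  shows "is_cdf (\<lambda>x. min 1 (F x + g x))"
  unfolding is_cdf_def
proof (intro conjI allI)
  have F': "mono F" "\<And>x. continuous (at_right x) F" "\<And>x. 0 \<le> F x" "\<And>x. F x \<le> 1"
    "(F \<longlongrightarrow> 0) at_bot" "(F \<longlongrightarrow> 1) at_top"
    using F by (auto simp: is_cdf_def)
  show "mono (\<lambda>x. min 1 (F x + g x))"
    by (intro monoI min.mono add_mono order_refl monoD[OF F'(1)] monoD[OF g(3)])
  show "continuous (at_right x) (\<lambda>x. min 1 (F x + g x))" for x
    by (intro continuous_min continuous_add continuous_const F' g)
  show "0 \<le> min 1 (F x + g x)" "min 1 (F x + g x) \<le> 1" for x
    using F'(3) g(1) by auto
  show "((\<lambda>x. min 1 (F x + g x)) \<longlongrightarrow> 0) at_bot"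
    using tendsto_min[OF tendsto_const tendsto_add[OF F'(5) g(4)], of 1] by simp
  \<comment> \<open>No limit of \<open>g\<close> at +infinity is given, and \<open>g\<close> may be
    unbounded; but \<open>F\<close> \<le> 1 and \<open>g\<close> \<ge> 0 squeeze the truncated sum
    between \<open>F\<close> and 1.\<close>
  show "((\<lambda>x. min 1 (F x + g x)) \<longlongrightarrow> 1) at_top"
    by (rule tendsto_sandwich[OF _ _ F'(6) tendsto_const])
      (use F'(4) g(1) in \<open>auto intro!: always_eventually\<close>)
qed

lemma (in prob_space) is_cdf_cdf_distr:
  assumes "Z \<in> borel_measurable M"
  shows "is_cdf (cdf (distr M borel Z))"
proof -
  interpret D: real_distribution "distr M borel Z"
    using assms by (simp add: real_distribution_distr)
  show ?thesis
    unfolding is_cdf_def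
    using D.cdf_nondecreasing D.cdf_is_right_cont D.cdf_nonneg D.cdf_bounded_prob
      D.cdf_lim_at_bot D.cdf_lim_at_top_prob
    by (auto simp: mono_def)
qed

theorem theorem2p6:
  fixes M :: "'a measure" and N :: "'b measure"
    and X :: "'a \<Rightarrow> real" and Y :: "'b \<Rightarrow> real"
    and g :: "real \<Rightarrow> real" and \<alpha> :: real and F\<^sub>L :: "real \<Rightarrow> real"
  assumes "0 < \<alpha>" and "\<alpha> < 1"
    and "prob_space M" and "integrable M X"
    and "prob_space N" and "integrable N Y"
    and "\<And>x. 0 \<le> g x" and "\<And>x. continuous (at_right x) g" and "mono g"
    and "(g \<longlongrightarrow> 0) at_bot"
    and "\<And>y. F\<^sub>L y = min 1 (cdf (distr N borel Y) y + g y)"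
    and "\<And>x. cdf (distr M borel X) x \<le> cdf (distr N borel Y) x + g x"
  shows "is_cdf F\<^sub>L \<and>
    (\<forall>(P :: 'c measure) (Y\<^sub>L :: 'c \<Rightarrow> real).
       prob_space P \<longrightarrow> Y\<^sub>L \<in> borel_measurable P \<longrightarrow> cdf (distr P borel Y\<^sub>L) = F\<^sub>L \<longrightarrow>
       CVaR P \<alpha> Y\<^sub>L \<le> CVaR M \<alpha> X)"
proof -
  have X: "X \<in> borel_measurable M" and Y: "Y \<in> borel_measurable N"
    using assms(4,6) by auto
  have FL: "F\<^sub>L = (\<lambda>y. min 1 (cdf (distr N borel Y) y + g y))"
    using assms(11) by blast
  have "is_cdf F\<^sub>L"
    unfolding FL
    by (intro is_cdf_min_one_add prob_space.is_cdf_cdf_distr[OF assms(5) Y] assms(7-10))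
  \<comment> \<open>The CDF of \<open>X\<close> is at most 1, so its bound by the untruncated sum
    passes to \<open>F\<^sub>L\<close>.\<close>
  moreover have "is_cdf (cdf (distr M borel X))"
    by (rule prob_space.is_cdf_cdf_distr[OF assms(3) X])
  then have "cdf (distr M borel X) x \<le> F\<^sub>L x" for x
    using assms(12) by (auto simp: FL is_cdf_def)
  ultimately show ?thesis
    \<comment> \<open>If \<open>g\<close> decays slowly at -infinity, \<open>Y\<^sub>L\<close> can
      have mean -infinity; the comparison of CDFs still applies, as it asks only for
      measurability.\<close>
    using assms(1,3) X by (auto intro!: CVaR_antimono_cdf)
qed

end
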